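(* Let $S$ be a semigroup, let $\sigma : S\to S$ be an involutive morphism of $S$, and let $\mu$ be a complex measure on $S$ that is a linear combination of Dirac measures $(\delta_{z_i})_{i\in I}$ with $z_i$ contained in the center of $S$ for all $i\in I$. The non-zero solutions $f: S\to\mathbb{C}$ of the functional equation $$\int_{S}f(\sigma(y)xt)\,d\mu(t)-\int_{S}f(xyt)\,d\mu(t) = 2f(x)f(y),\quad x,y\in S,$$ are exactly the functions of the form $$f=\frac{\chi\circ\sigma-\chi}{2}\int_{S}\chi(t)\,d\mu(t),$$ where $\chi: S\to\mathbb{C}$ is a multiplicative function such that $\int_{S}\chi(t)\,d\mu(t)\neq 0$ and $\int_{S}\chi(\sigma(t))\,d\mu(t)=-\int_{S}\chi(t)\,d\mu(t)$. Moreover, if $S$ is a topological semigroup and $\sigma: S\to S$ is continuous, then such a non-zero solution $f$ is continuous if and only if $\chi$ is continuous.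
   Context: An involutive morphism $\sigma$ of a semigroup $S$ is a map $\sigma:S\to S$ with $\sigma(\sigma(x))=x$ for all $x\in S$ that is either an automorphism ($\sigma(xy)=\sigma(x)\sigma(y)$ for all $x,y$) or an anti-automorphism ($\sigma(xy)=\sigma(y)\sigma(x)$ for all $x,y$). The center of $S$ is the set of elements commuting with every element of $S$. If $\mu=\sum_{i\in I}c_i\delta_{z_i}$ (a finite linear combination, $c_i\in\mathbb{C}$), then $\int_S h(t)\,d\mu(t)=\sum_{i\in I}c_i h(z_i)$ for every $h:S\to\mathbb{C}$. A function $\chi:S\to\mathbb{C}$ is multiplicative if $\chi(xy)=\chi(x)\chi(y)$ for all $x,y\in S$. *)

theory Defs
  imports "HOL-Analysis.Analysis"
begin

definition involutive_morphism :: "('a::semigroup_mult \<Rightarrow> 'a) \<Rightarrow> bool" where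
  "involutive_morphism \<sigma> \<longleftrightarrow>
     (\<forall>x. \<sigma> (\<sigma> x) = x) \<and>
     ((\<forall>x y. \<sigma> (x * y) = \<sigma> x * \<sigma> y) \<or> (\<forall>x y. \<sigma> (x * y) = \<sigma> y * \<sigma> x))"

definition semigroup_center :: "'a::semigroup_mult set" where
  "semigroup_center = {z. \<forall>x. z * x = x * z}"

definition multiplicative :: "('a::semigroup_mult \<Rightarrow> complex) \<Rightarrow> bool" where
  "multiplicative \<psi> \<longleftrightarrow> (\<forall>x y. \<psi> (x * y) = \<psi> x * \<psi> y)"

text \<open>
  The integral of \<open>h\<close> against the complex measure \<open>\<Sum>i\<in>I. c i * \<delta>(z i)\<close>, for a finite index
  set \<open>I\<close>. The measure is given by the data \<open>(I, c, z)\<close>; the points \<open>z i\<close> need not be distinct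
  and the weights \<open>c i\<close> may vanish.
\<close>
definition dirac_integral ::
    "'i set \<Rightarrow> ('i \<Rightarrow> complex) \<Rightarrow> ('i \<Rightarrow> 'a) \<Rightarrow> ('a \<Rightarrow> complex) \<Rightarrow> complex" where
  "dirac_integral I c z h = (\<Sum>i\<in>I. c i * h (z i))"

text \<open>
  The topology is an explicit argument rather than a type class, so that purely algebraic and
  topological claims can be made about one and the same semigroup. No separation axiom is imposed.
\<close>
definition topological_semigroup :: "'a::semigroup_mult topology \<Rightarrow> bool" where
  "topological_semigroup T \<longleftrightarrow>
     topspace T = UNIV \<and> continuous_map (prod_topology T T) T (\<lambda>(x, y). x * y)"

end

theory Submission
  imports Defs
begin

text \<open>
  Write \<open>F(x) = \<integral> f(xt) d\<mu>(t)\<close>, so that the equation reads \<open>F(\<sigma>(y)x) - F(xy) = 2 f(x) f(y)\<close>.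
  Replacing \<open>x\<close>, \<open>y\<close> by their images under \<open>\<sigma>\<close> shows that \<open>f\<close> is odd and \<open>F(\<sigma>(x)\<sigma>(y)) = F(xy)\<close>.
  Averaging over the central points \<open>z i\<close> then gives \<open>\<integral> F(xt) d\<mu>(t) = -l f(x)\<close> with \<open>l = \<integral> f d\<mu>\<close>,
  and averaging the equation in \<open>x\<close> and in \<open>y\<close> separately gives the sine addition law
  \<open>l f(xy) = f(x) F(y) + F(x) f(y)\<close>. One more average produces the cosine addition law for
  \<open>g = F/l\<close>, namely \<open>g(xy) = g(x) g(y) - f(x) f(y)/l\<close>. Hence \<open>\<psi> = g - f/m\<close> is multiplicative
  when \<open>m\<^sup>2 = -l\<close>. Conversely \<open>g = (\<psi> \<circ> \<sigma> + \<psi>)/2\<close> is recovered from \<open>f\<close> by averaging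
  translates of \<open>f\<close>, which is why continuity of \<open>f\<close> passes to \<open>\<psi>\<close>.
\<close>

section \<open>Linearity of the integral and interchange of two integrals\<close>

lemma dirac_integral_add:
  "dirac_integral I c z (\<lambda>t. h t + k t) = dirac_integral I c z h + dirac_integral I c z k"
  by (simp add: dirac_integral_def sum.distrib algebra_simps)

lemma dirac_integral_diff:
  "dirac_integral I c z (\<lambda>t. h t - k t) = dirac_integral I c z h - dirac_integral I c z k"
  by (simp add: dirac_integral_def sum_subtractf algebra_simps)

lemma dirac_integral_minus:
  "dirac_integral I c z (\<lambda>t. - h t) = - dirac_integral I c z h"
  by (simp add: dirac_integral_def sum_negf)

lemma dirac_integral_cmult:
  "dirac_integral I c z (\<lambda>t. a * h t) = a * dirac_integral I c z h"
  unfolding dirac_integral_def sum_distrib_left by (intro sum.cong refl mult.left_commute)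

lemma dirac_integral_multc:
  "dirac_integral I c z (\<lambda>t. h t * a) = dirac_integral I c z h * a"
  by (simp add: dirac_integral_def sum_distrib_right mult.assoc)

lemma dirac_integral_divide:
  "dirac_integral I c z (\<lambda>t. h t / a) = dirac_integral I c z h / a"
  by (simp add: dirac_integral_def sum_divide_distrib)

lemmas dirac_integral_linear =
  dirac_integral_add dirac_integral_diff dirac_integral_minus
  dirac_integral_cmult dirac_integral_multc dirac_integral_divide

lemma dirac_integral_cong:
  "(\<And>i. i \<in> I \<Longrightarrow> h (z i) = k (z i)) \<Longrightarrow> dirac_integral I c z h = dirac_integral I c z k"
  by (simp add: dirac_integral_def)

lemma dirac_integral_swap:
  "dirac_integral I c z (\<lambda>s. dirac_integral I c z (\<lambda>t. h s t)) =
   dirac_integral I c z (\<lambda>t. dirac_integral I c z (\<lambda>s. h s t))"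
  unfolding dirac_integral_def sum_distrib_left
  by (subst sum.swap) (simp add: mult_ac)

text \<open>Applying \<sigma> to the commutation of \<open>s\<close> with \<open>\<sigma> x\<close>
  works for either kind of morphism. It is needed because central points put in place of
  \<open>y\<close> enter the equation as \<open>\<sigma> (z i)\<close>.\<close>

lemma involutive_morphism_center:
  assumes "involutive_morphism \<sigma>" and "s \<in> semigroup_center"
  shows "\<sigma> s \<in> semigroup_center"
proof -
  have "\<sigma> s * x = x * \<sigma> s" for x
    using assms unfolding involutive_morphism_def semigroup_center_def mem_Collect_eq by metis
  then show ?thesis
    by (simp add: semigroup_center_def)
qed

text \<open>Complex multiplication commutes, so a reversal of the product by \<sigma> is invisible
  to \<psi>.\<close>

lemma multiplicative_involutive_morphism:
  assumes "involutive_morphism \<sigma>" and "multiplicative \<psi>"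
  shows "\<psi> (\<sigma> (x * y)) = \<psi> (\<sigma> x) * \<psi> (\<sigma> y)"
  using assms unfolding involutive_morphism_def multiplicative_def by (metis mult.commute)

section \<open>Multiplicative functions give solutions\<close>

text \<open>The sign change of the integral under \<sigma> turns the difference in \<open>f\<close>
  into a sum: averaging sends the odd part of \<psi> to a multiple of its even part.\<close>

lemma dirac_integral_translate:
  assumes "involutive_morphism \<sigma>" and "multiplicative \<psi>"
    and "dirac_integral I c z (\<lambda>t. \<psi> (\<sigma> t)) = - dirac_integral I c z \<psi>"
    and "f = (\<lambda>x. (\<psi> (\<sigma> x) - \<psi> x) / 2 * dirac_integral I c z \<psi>)"
  shows "dirac_integral I c z (\<lambda>t. f (x * t)) =
         - (dirac_integral I c z \<psi>)\<^sup>2 / 2 * (\<psi> (\<sigma> x) + \<psi> x)"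
proof -
  have "dirac_integral I c z (\<lambda>t. f (x * t)) =
        (\<psi> (\<sigma> x) * dirac_integral I c z (\<lambda>t. \<psi> (\<sigma> t)) - \<psi> x * dirac_integral I c z \<psi>) / 2
          * dirac_integral I c z \<psi>"
    using assms(2) unfolding assms(4) multiplicative_def
    by (simp add: multiplicative_involutive_morphism[OF assms(1,2)] dirac_integral_linear)
  also have "\<dots> = - (dirac_integral I c z \<psi>)\<^sup>2 / 2 * (\<psi> (\<sigma> x) + \<psi> x)"
    unfolding assms(3) by (simp add: power2_eq_square field_simps)
  finally show ?thesis .
qed

text \<open>With \<open>m\<close> the integral of \<psi>, both sides of the equation equal
  \<open>m\<^sup>2 / 2 * (\<psi> (\<sigma> x) - \<psi> x) * (\<psi> (\<sigma> y) - \<psi>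
  y)\<close>. If \<open>f\<close> vanished, \<psi> would be even and \<open>m = - m\<close>.\<close>

lemma multiplicative_imp_solution:
  assumes \<sigma>: "involutive_morphism \<sigma>" and \<psi>: "multiplicative \<psi>"
    and nz: "dirac_integral I c z \<psi> \<noteq> 0"
    and anti: "dirac_integral I c z (\<lambda>t. \<psi> (\<sigma> t)) = - dirac_integral I c z \<psi>"
    and f: "f = (\<lambda>x. (\<psi> (\<sigma> x) - \<psi> x) / 2 * dirac_integral I c z \<psi>)"
  shows "f \<noteq> (\<lambda>_. 0)"
    and "dirac_integral I c z (\<lambda>t. f (\<sigma> y * x * t))
           - dirac_integral I c z (\<lambda>t. f (x * y * t)) = 2 * f x * f y"
proof -
  show "f \<noteq> (\<lambda>_. 0)"
  proof
    assume "f = (\<lambda>_. 0)"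
    then have "\<psi> (\<sigma> x) = \<psi> x" for x
      using nz unfolding f by (auto dest: fun_cong[of _ _ x])
    then show False
      using anti nz by simp
  qed
  have "\<sigma> (\<sigma> y) = y"
    using \<sigma> by (simp add: involutive_morphism_def)
  then show "dirac_integral I c z (\<lambda>t. f (\<sigma> y * x * t))
           - dirac_integral I c z (\<lambda>t. f (x * y * t)) = 2 * f x * f y"
    using \<psi> unfolding dirac_integral_translate[OF \<sigma> \<psi> anti f] multiplicative_def
    by (simp add: f multiplicative_involutive_morphism[OF \<sigma> \<psi>] power2_eq_square field_simps)
qed

section \<open>Solutions come from multiplicative functions\<close>

lemma solution_imp_multiplicative:
  fixes f :: "'a::semigroup_mult \<Rightarrow> complex"
  assumes \<sigma>: "involutive_morphism \<sigma>"
    and center: "\<forall>i\<in>I. z i \<in> semigroup_center"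
    and nz: "f \<noteq> (\<lambda>_. 0)"
    and eq: "\<And>x y. dirac_integral I c z (\<lambda>t. f (\<sigma> y * x * t))
              - dirac_integral I c z (\<lambda>t. f (x * y * t)) = 2 * f x * f y"
  shows "\<exists>\<psi>. multiplicative \<psi> \<and>
             dirac_integral I c z \<psi> \<noteq> 0 \<and>
             dirac_integral I c z (\<lambda>t. \<psi> (\<sigma> t)) = - dirac_integral I c z \<psi> \<and>
             f = (\<lambda>x. (\<psi> (\<sigma> x) - \<psi> x) / 2 * dirac_integral I c z \<psi>)"
proof -
  define J where "J = dirac_integral I c z"
  note J_linear = dirac_integral_linear[of I c z, folded J_def]
  have J_cong: "J h = J k" if "\<And>i. i \<in> I \<Longrightarrow> h (z i) = k (z i)" for h k
    using that unfolding J_def by (rule dirac_integral_cong)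
  define F where "F x = J (\<lambda>t. f (x * t))" for x
  define G where "G x = J (\<lambda>s. F (x * s))" for x
  define l where "l = J f"
  have FE: "F (\<sigma> y * x) - F (x * y) = 2 * f x * f y" for x y
    unfolding F_def J_def by (rule eq)
  have inv: "\<sigma> (\<sigma> x) = x" for x
    using \<sigma> by (simp add: involutive_morphism_def)
  have zc: "z i * x = x * z i" and \<sigma>zc: "\<sigma> (z i) * x = x * \<sigma> (z i)" if "i \<in> I" for i x
    using center that involutive_morphism_center[OF \<sigma>]
    unfolding semigroup_center_def by blast+

  \<comment> \<open>The instances at \<open>(x, y)\<close> and \<open>(\<sigma> y, x)\<close>
    telescope through \<open>F (\<sigma> y * x)\<close>, with no need to know whether \<sigma>
    reverses products.\<close>
  have even_defect: "F (\<sigma> x * \<sigma> y) - F (x * y) = 2 * f x * (f y + f (\<sigma> y))" for x y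
    using FE[where x = y and y = x] FE[where x = x and y = y]
      FE[where x = "\<sigma> y" and y = x] FE[where x = x and y = "\<sigma> y"]
    by (simp add: inv algebra_simps)
  \<comment> \<open>Passing to \<open>(\<sigma> x, \<sigma> y)\<close> reverses the sign of the left
    side of \<open>even_defect\<close>, so the two right sides add up to zero; \<open>y = x\<close>
    then yields a vanishing square.\<close>
  have "2 * ((f x + f (\<sigma> x)) * (f y + f (\<sigma> y))) = 0" for x y
    using arg_cong2[of _ _ _ _ "(+)", OF even_defect[where x = x and y = y]
        even_defect[where x = "\<sigma> x" and y = "\<sigma> y"]]
    by (simp add: inv algebra_simps)
  then have "(f x + f (\<sigma> x)) * (f y + f (\<sigma> y)) = 0" for x y
    by simp
  then have "f x + f (\<sigma> x) = 0" for x
    using mult_eq_0_iff by blast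
  then have odd: "f (\<sigma> x) = - f x" for x
    by (metis add.commute eq_neg_iff_add_eq_0)
  have F\<sigma>\<sigma>: "F (\<sigma> x * \<sigma> y) = F (x * y)" for x y
    using even_defect[where x = x and y = y] by (simp add: odd)
  have F\<sigma>: "F (x * \<sigma> y) = F (\<sigma> x * y)" for x y
    using F\<sigma>\<sigma>[where x = "\<sigma> x" and y = y] by (simp add: inv)

  have G_defect: "G (\<sigma> x) - G x = 2 * f x * l" for x
  proof -
    have "F (\<sigma> x * z i) - F (x * z i) = 2 * f x * f (z i)" if "i \<in> I" for i
      using FE[where x = x and y = "z i"] F\<sigma>[where x = x and y = "z i"] \<sigma>zc[OF that] by simp
    then have "J (\<lambda>s. F (\<sigma> x * s) - F (x * s)) = J (\<lambda>s. 2 * f x * f s)"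
      by (intro J_cong)
    then show ?thesis
      by (simp add: G_def l_def J_linear)
  qed
  have G_odd: "G (\<sigma> x) = - G x" for x
  proof -
    \<comment> \<open>Up to the order of central factors, \<sigma> exchanges the roles of
      \<open>i\<close> and \<open>j\<close>; swapping the two integrals below undoes this and leaves
      only the sign from \<open>odd\<close>.\<close>
    have flip: "f (x * \<sigma> (z i) * z j) = - f (\<sigma> x * \<sigma> (z j) * z i)" if "i \<in> I" "j \<in> I" for i j
    proof -
      have "\<sigma> (x * \<sigma> (z i) * z j) = \<sigma> x * \<sigma> (z j) * z i"
        using \<sigma> zc[OF that(1)] \<sigma>zc[OF that(2)]
        unfolding involutive_morphism_def by (metis mult.assoc)
      then show ?thesis
        using odd by (metis minus_minus)
    qed
    have "G (\<sigma> x) = J (\<lambda>s. J (\<lambda>t. f (x * \<sigma> s * t)))"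
      unfolding G_def F\<sigma>[symmetric] by (simp add: F_def)
    also have "\<dots> = J (\<lambda>s. J (\<lambda>t. - f (\<sigma> x * \<sigma> t * s)))"
      by (intro J_cong flip)
    also have "\<dots> = - J (\<lambda>t. J (\<lambda>s. f (\<sigma> x * \<sigma> t * s)))"
      unfolding J_linear unfolding J_def by (subst dirac_integral_swap) simp
    also have "\<dots> = - J (\<lambda>t. F (\<sigma> x * \<sigma> t))"
      by (simp add: F_def)
    finally show ?thesis
      by (simp add: F\<sigma>\<sigma> G_def)
  qed
  have G: "G x = - l * f x" for x
  proof -
    have "G x = - ((G (\<sigma> x) - G x) / 2)"
      by (simp add: G_odd)
    then show ?thesis
      by (simp add: G_defect)
  qed

  have sine: "l * f (x * y) = f x * F y + F x * f y" for x y
  proof -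
    \<comment> \<open>First average: \<open>x\<close> is replaced by \<open>x * z i\<close>.\<close>
    have "F (\<sigma> y * x * z i) - F (x * y * z i) = 2 * f (x * z i) * f y" if "i \<in> I" for i
      using FE[where x = "x * z i" and y = y] zc[OF that] by (simp add: mult.assoc)
    then have "J (\<lambda>s. F (\<sigma> y * x * s) - F (x * y * s)) = J (\<lambda>s. 2 * f (x * s) * f y)"
      by (intro J_cong)
    then have 1: "G (\<sigma> y * x) - G (x * y) = 2 * F x * f y"
      by (simp add: G_def F_def J_linear mult.assoc)
    \<comment> \<open>Second average: \<open>y\<close> is replaced by \<open>y * z i\<close>. The
      outer \<sigma> stays unevaluated so that \<open>G_odd\<close> cancels this term against
      \<open>G (\<sigma> y * x)\<close> when both averages are added.\<close>
    have "F (\<sigma> (\<sigma> y * x) * z i) - F (x * y * z i) = 2 * f x * f (y * z i)" if "i \<in> I" for i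
    proof -
      have "\<sigma> (y * z i) * x = \<sigma> y * x * \<sigma> (z i)"
        using \<sigma> \<sigma>zc[OF that] unfolding involutive_morphism_def by (metis mult.assoc)
      then show ?thesis
        using FE[where x = x and y = "y * z i"] F\<sigma>[where x = "\<sigma> y * x" and y = "z i"]
        by (simp add: mult.assoc)
    qed
    then have "J (\<lambda>s. F (\<sigma> (\<sigma> y * x) * s) - F (x * y * s)) = J (\<lambda>s. 2 * f x * f (y * s))"
      by (intro J_cong)
    then have 2: "G (\<sigma> (\<sigma> y * x)) - G (x * y) = 2 * f x * F y"
      by (simp add: G_def F_def J_linear mult.assoc)
    have "- 2 * G (x * y) = 2 * F x * f y + 2 * f x * F y"
      unfolding 1[symmetric] 2[symmetric] G_odd by simp
    then have "2 * (l * f (x * y)) = 2 * (f x * F y + F x * f y)"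
      by (simp add: G algebra_simps)
    then show ?thesis
      by (subst (asm) mult_cancel_left) simp
  qed

  obtain a where a: "f a \<noteq> 0"
    using nz by auto
  have "F \<noteq> (\<lambda>_. 0)"
    using FE[where x = a and y = a] a by auto
  then obtain b where b: "F b \<noteq> 0"
    by auto
  have l: "l \<noteq> 0"
  proof
    assume "l = 0"
    then have *: "f x * F y + F x * f y = 0" for x y
      using sine[of x y] by simp
    from *[of a a] a have "F a = 0"
      by simp
    with *[of a b] a b show False
      by simp
  qed

  \<comment> \<open>Dividing by \<open>l\<close> turns \<open>sine\<close> into the usual sine
    addition law, and one more average of \<open>g\<close> returns \<open>- f\<close>.\<close>
  define g where "g x = F x / l" for x
  have f_mult: "f (x * y) = f x * g y + g x * f y" for x y
    using sine[of x y] l by (simp add: g_def field_simps)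
  have J_g: "J (\<lambda>s. g (x * s)) = - f x" for x
    using G[of x] l by (simp add: g_def J_linear G_def)
  have g_mult: "g (x * y) = g x * g y - f x * f y / l" for x y
  proof -
    \<comment> \<open>Expand \<open>f (x * (y * s))\<close> by the sine law and integrate over
      \<open>s\<close>.\<close>
    have "F (x * y) = J (\<lambda>s. f x * g (y * s) + g x * f (y * s))"
      by (simp add: F_def mult.assoc f_mult[where x = x])
    also have "\<dots> = - f x * f y + g x * F y"
      by (simp add: J_linear J_g F_def)
    finally show ?thesis
      using l by (simp add: g_def field_simps)
  qed
  have gb: "g b \<noteq> 0"
    using b l by (simp add: g_def)
  have g_even: "g (\<sigma> y) = g y" for y
  proof -
    \<comment> \<open>In the equation at \<open>x = b\<close>, the cosine law and oddness of
      \<open>f\<close> produce \<open>2 * f b * f y\<close> on the left as well, leaving a multiple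
      of \<open>g b\<close>, which is nonzero.\<close>
    have "l * g (\<sigma> y * b) - l * g (b * y) = 2 * f b * f y"
      using FE[where x = b and y = y] l by (simp add: g_def)
    then have "l * (g b * (g (\<sigma> y) - g y)) = 0"
      using l by (simp add: g_mult odd field_simps)
    then show ?thesis
      using l gb by simp
  qed
  have g_int: "J g = 0"
  proof -
    have "J (\<lambda>s. g b * g s - f b * f s / l) = - f b"
      using J_g[of b] by (simp add: g_mult)
    then show ?thesis
      using l gb by (simp add: J_linear flip: l_def)
  qed

  \<comment> \<open>For \<open>g + k * f\<close> to be multiplicative, the two addition laws ask for
    \<open>k\<^sup>2 = - 1 / l\<close>. Taking \<open>k = - 1 / m\<close> makes the integral of
    \<psi> equal to \<open>m\<close>; the other root would give
    \<open>\<psi> \<circ> \<sigma>\<close>, which represents the same \<open>f\<close>.\<close>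
  define m where "m = csqrt (- l)"
  have m2: "m * m = - l" and m: "m \<noteq> 0"
    using l power2_csqrt[of "- l"] by (auto simp: m_def power2_eq_square)
  define \<psi> where "\<psi> x = g x - f x / m" for x
  have "multiplicative \<psi>"
    unfolding multiplicative_def
  proof (intro allI)
    fix x y
    have "f x * f y / l = - (f x / m * (f y / m))"
      using m2 by simp
    then show "\<psi> (x * y) = \<psi> x * \<psi> y"
      unfolding \<psi>_def f_mult g_mult by (simp add: add_divide_distrib algebra_simps)
  qed
  moreover have \<psi>_int: "J \<psi> = m"
    using m m2 unfolding \<psi>_def J_linear g_int by (simp add: field_simps flip: l_def)
  moreover have "J (\<lambda>t. \<psi> (\<sigma> t)) = - m"
    using m m2 unfolding \<psi>_def odd g_even J_linear g_int by (simp add: field_simps flip: l_def)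
  moreover have "f = (\<lambda>x. (\<psi> (\<sigma> x) - \<psi> x) / 2 * J \<psi>)"
    using m unfolding \<psi>_int by (simp add: \<psi>_def odd g_even)
  ultimately show ?thesis
    using m unfolding J_def by auto
qed

section \<open>Continuity\<close>

lemma topological_semigroup_right_translation:
  assumes "topological_semigroup T"
  shows "continuous_map T T (\<lambda>x. x * a)"
proof -
  have "continuous_map T (prod_topology T T) (\<lambda>x. (x, a))"
    using assms by (simp add: topological_semigroup_def continuous_map_pairwise o_def)
  then show ?thesis
    using assms continuous_map_compose unfolding topological_semigroup_def
    by (fastforce simp: o_def)
qed

lemma continuous_map_cmult:
  fixes f :: "'a \<Rightarrow> 'b::real_normed_algebra"
  shows "continuous_map X euclidean f \<Longrightarrow> continuous_map X euclidean (\<lambda>x. a * f x)"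
  by (simp add: continuous_map_atin tendsto_mult)

lemma continuous_map_dirac_integral:
  assumes "topological_semigroup T" and "finite I" and "continuous_map T euclidean f"
  shows "continuous_map T euclidean (\<lambda>x. dirac_integral I c z (\<lambda>t. f (x * t)))"
proof -
  have "continuous_map T euclidean (\<lambda>x. f (x * a))" for a
    using continuous_map_compose[OF topological_semigroup_right_translation[OF assms(1)] assms(3)]
    by (simp add: o_def)
  then show ?thesis
    unfolding dirac_integral_def using \<open>finite I\<close>
    by (intro continuous_map_sum continuous_map_cmult)
qed

text \<open>The odd part of \<psi> is a multiple of \<open>f\<close> and the even part a multiple of
  the average of translates of \<open>f\<close>, so continuity of \<open>f\<close> gives that of
  \<psi>. The converse uses continuity of \<sigma>.\<close>

lemma continuous_solution_iff:
  assumes T: "topological_semigroup T" "continuous_map T T \<sigma>" and "finite I"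
    and \<sigma>: "involutive_morphism \<sigma>" and \<psi>: "multiplicative \<psi>"
    and nz: "dirac_integral I c z \<psi> \<noteq> 0"
    and anti: "dirac_integral I c z (\<lambda>t. \<psi> (\<sigma> t)) = - dirac_integral I c z \<psi>"
    and f: "f = (\<lambda>x. (\<psi> (\<sigma> x) - \<psi> x) / 2 * dirac_integral I c z \<psi>)"
  shows "continuous_map T euclidean f \<longleftrightarrow> continuous_map T euclidean \<psi>"
proof
  let ?m = "dirac_integral I c z \<psi>"
  {
    assume "continuous_map T euclidean \<psi>"
    moreover from this have "continuous_map T euclidean (\<lambda>x. \<psi> (\<sigma> x))"
      using continuous_map_compose[OF T(2)] by (simp add: o_def)
    ultimately have "continuous_map T euclidean (\<lambda>x. ?m / 2 * (\<psi> (\<sigma> x) - \<psi> x))"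
      by (intro continuous_map_cmult continuous_map_diff)
    then show "continuous_map T euclidean f"
      by (simp add: f mult.commute)
  }
  assume cont: "continuous_map T euclidean f"
  let ?F = "\<lambda>x. dirac_integral I c z (\<lambda>t. f (x * t))"
  \<comment> \<open>The first term is \<open>(\<psi> (\<sigma> x) + \<psi> x) / 2\<close>, and
    \<open>(\<psi> (\<sigma> x) - \<psi> x) / 2\<close> is subtracted from it.\<close>
  have "continuous_map T euclidean (\<lambda>x. - 1 / ?m\<^sup>2 * ?F x - 1 / ?m * f x)"
    using continuous_map_dirac_integral[OF T(1) \<open>finite I\<close> cont] cont
    by (intro continuous_map_cmult continuous_map_diff)
  moreover have "- 1 / ?m\<^sup>2 * ?F x - 1 / ?m * f x = \<psi> x" for x
    unfolding dirac_integral_translate[OF \<sigma> \<psi> anti f] using nz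
    by (simp add: f power2_eq_square field_simps)
  ultimately show "continuous_map T euclidean \<psi>"
    by simp
qed

theorem theorem2p3:
  fixes \<sigma> :: "'a::semigroup_mult \<Rightarrow> 'a"
    and I :: "'i set" and c :: "'i \<Rightarrow> complex" and z :: "'i \<Rightarrow> 'a"
  assumes "involutive_morphism \<sigma>"
    and "finite I"
    and "\<forall>i\<in>I. z i \<in> semigroup_center"
  shows
    "(\<forall>f :: 'a \<Rightarrow> complex.
        (f \<noteq> (\<lambda>_. 0) \<and>
         (\<forall>x y. dirac_integral I c z (\<lambda>t. f (\<sigma> y * x * t))
              - dirac_integral I c z (\<lambda>t. f (x * y * t)) = 2 * f x * f y))
        \<longleftrightarrow>
        (\<exists>\<psi>. multiplicative \<psi> \<and>
             dirac_integral I c z \<psi> \<noteq> 0 \<and>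
             dirac_integral I c z (\<lambda>t. \<psi> (\<sigma> t)) = - dirac_integral I c z \<psi> \<and>
             f = (\<lambda>x. (\<psi> (\<sigma> x) - \<psi> x) / 2 * dirac_integral I c z \<psi>)))
     \<and>
     (\<forall>T. topological_semigroup T \<and> continuous_map T T \<sigma> \<longrightarrow>
        (\<forall>(f :: 'a \<Rightarrow> complex) \<psi>.
           multiplicative \<psi> \<and>
           dirac_integral I c z \<psi> \<noteq> 0 \<and>
           dirac_integral I c z (\<lambda>t. \<psi> (\<sigma> t)) = - dirac_integral I c z \<psi> \<and>
           f = (\<lambda>x. (\<psi> (\<sigma> x) - \<psi> x) / 2 * dirac_integral I c z \<psi>) \<longrightarrow>
           (continuous_map T euclidean f \<longleftrightarrow> continuous_map T euclidean \<psi>)))"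
proof (intro conjI allI impI iffI; (elim conjE exE)?)
  fix f :: "'a \<Rightarrow> complex"
  assume "f \<noteq> (\<lambda>_. 0)"
    and "\<forall>x y. dirac_integral I c z (\<lambda>t. f (\<sigma> y * x * t))
              - dirac_integral I c z (\<lambda>t. f (x * y * t)) = 2 * f x * f y"
  then show "\<exists>\<psi>. multiplicative \<psi> \<and>
             dirac_integral I c z \<psi> \<noteq> 0 \<and>
             dirac_integral I c z (\<lambda>t. \<psi> (\<sigma> t)) = - dirac_integral I c z \<psi> \<and>
             f = (\<lambda>x. (\<psi> (\<sigma> x) - \<psi> x) / 2 * dirac_integral I c z \<psi>)"
    using solution_imp_multiplicative[OF assms(1,3)] by blast
next
  fix f :: "'a \<Rightarrow> complex" and \<psi>
  assume \<psi>: "multiplicative \<psi>" "dirac_integral I c z \<psi> \<noteq> 0"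
    "dirac_integral I c z (\<lambda>t. \<psi> (\<sigma> t)) = - dirac_integral I c z \<psi>"
    "f = (\<lambda>x. (\<psi> (\<sigma> x) - \<psi> x) / 2 * dirac_integral I c z \<psi>)"
  note sol = multiplicative_imp_solution[OF assms(1) \<psi>]
  show "f \<noteq> (\<lambda>_. 0)"
    by (rule sol(1))
  show "dirac_integral I c z (\<lambda>t. f (\<sigma> y * x * t))
          - dirac_integral I c z (\<lambda>t. f (x * y * t)) = 2 * f x * f y" for x y
    by (rule sol(2))
  fix T
  assume T: "topological_semigroup T" "continuous_map T T \<sigma>"
  note iff = continuous_solution_iff[OF T assms(2,1) \<psi>]
  show "continuous_map T euclidean \<psi>" if "continuous_map T euclidean f"
    using iff that by blast
  show "continuous_map T euclidean f" if "continuous_map T euclidean \<psi>"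
    using iff that by blast
qed

end
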